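(* The standard embedding $\varphi:\mathbb{R}^n/\mathbb{Z}^n\to\mathbb{R}^{2n}$ of the standard torus $\mathbb{R}^n/\mathbb{Z}^n$, given by $$\varphi(x_1,\ldots,x_n)=(\cos2\pi x_1,\ \sin2\pi x_1,\ \ldots,\ \cos2\pi x_n,\ \sin2\pi x_n),$$ is a least distortion embedding, i.e. $\mathrm{dist}(\varphi)=c_2(\mathbb{R}^n/\mathbb{Z}^n)$, and its distortion is $c_2(\mathbb{R}^n/\mathbb{Z}^n)=\pi/2$.
   Context: For an $n$-dimensional lattice $L\subseteq\mathbb{R}^n$ (here $L=\mathbb{Z}^n$), the flat torus $\mathbb{R}^n/L$ has the metric $d_{\mathbb{R}^n/L}(x,y)=\min_{v\in L}|x-y-v|$, where $|x|=\sqrt{x^{\mathsf T}x}$. A Euclidean embedding of $\mathbb{R}^n/L$ is an injective function $\varphi:\mathbb{R}^n/L\to H$ into some Hilbert space $H$. Its distortion is $$\mathrm{dist}(\varphi)=\sup_{x\ne y}\frac{\|\varphi(x)-\varphi(y)\|}{d_{\mathbb{R}^n/L}(x,y)}\cdot\sup_{x\neq y}\frac{d_{\mathbb{R}^n/L}(x,y)}{\|\varphi(x)-\varphi(y)\|},$$ with suprema over distinct $x,y\in\mathbb{R}^n/L$. The least (Euclidean) distortion is $c_2(\mathbb{R}^n/L)=\inf\{\mathrm{dist}(\varphi)\}$ over all Euclidean embeddings $\varphi$ of $\mathbb{R}^n/L$ into (complex) Hilbert spaces; real Euclidean target spaces such as $\mathbb{R}^{2n}$ are also allowed (they embed isometrically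 into complex Hilbert spaces). *)

theory Defs
  imports "HOL-Analysis.Analysis" "HOL-Algebra.Module"
begin

text \<open>The standard torus. Here $n$ is \<open>CARD('n)\<close>, which is at least one.\<close>

definition int_lattice :: "(real^'n) set" where
  "int_lattice = {v. \<forall>i. v $ i \<in> \<int>}"

lemma int_lattice_0: "0 \<in> int_lattice"
  and int_lattice_add: "\<lbrakk>u \<in> int_lattice; v \<in> int_lattice\<rbrakk> \<Longrightarrow> u + v \<in> int_lattice"
  and int_lattice_minus: "v \<in> int_lattice \<Longrightarrow> - v \<in> int_lattice"
  and int_lattice_diff: "\<lbrakk>u \<in> int_lattice; v \<in> int_lattice\<rbrakk> \<Longrightarrow> u - v \<in> int_lattice"
  by (auto simp: int_lattice_def)

definition lattice_rel :: "real^'n \<Rightarrow> real^'n \<Rightarrow> bool" where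
  "lattice_rel x y \<longleftrightarrow> x - y \<in> int_lattice"

quotient_type (overloaded) 'n torus = "real^'n::finite" / lattice_rel
proof (rule equivpI)
  show "reflp lattice_rel"
    by (simp add: reflp_def lattice_rel_def int_lattice_0)
  show "symp lattice_rel"
    using int_lattice_minus by (fastforce simp: symp_def lattice_rel_def)
  show "transp lattice_rel"
    using int_lattice_add by (fastforce simp: transp_def lattice_rel_def)
qed

lift_definition torus_dist :: "'n::finite torus \<Rightarrow> 'n torus \<Rightarrow> real"
  is "\<lambda>x y. INF v\<in>int_lattice. norm (x - y - v)"
proof -
  fix x x' y y' :: "real^'n"
  assume "lattice_rel x x'" "lattice_rel y y'"
  then have w: "(x - x') - (y - y') \<in> int_lattice" (is "?w \<in> _")
    unfolding lattice_rel_def by (rule int_lattice_diff)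
  have "(\<lambda>v. v - ?w) ` int_lattice = (int_lattice :: (real^'n) set)"
  proof (intro equalityI subsetI)
    fix v :: "real^'n" assume "v \<in> int_lattice"
    then have "v + ?w \<in> int_lattice" using w by (rule int_lattice_add)
    then show "v \<in> (\<lambda>v. v - ?w) ` int_lattice" by (rule rev_image_eqI) simp
  qed (use w int_lattice_diff in blast)
  then have "(INF v\<in>int_lattice. norm (x' - y' - v))
      = (INF v\<in>(\<lambda>v. v - ?w) ` int_lattice. norm (x' - y' - v))" by simp
  also have "\<dots> = (INF v\<in>int_lattice. norm (x - y - v))"
    by (simp add: image_image algebra_simps)
  finally show "(INF v\<in>int_lattice. norm (x - y - v)) = (INF v\<in>int_lattice. norm (x' - y' - v))" ..
qed

lemma closed_int_lattice: "closed (int_lattice :: (real^'n) set)"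
proof -
  have "closed {v :: real^'n. v $ i \<in> \<int>}" for i
    using continuous_closed_vimage[OF closed_Ints, of "\<lambda>v :: real^'n. v $ i"]
    by (simp add: vimage_def)
  then show ?thesis
    unfolding int_lattice_def by (rule closed_Collect_all)
qed

text \<open>The infimum is a minimum.\<close>

lemma torus_dist_attained:
  "\<exists>v\<in>int_lattice. torus_dist (abs_torus x) (abs_torus y) = norm (x - y - v)
     \<and> (\<forall>w\<in>int_lattice. norm (x - y - v) \<le> norm (x - y - w))"
proof -
  obtain v where v: "v \<in> int_lattice"
    and min: "\<And>w. w \<in> int_lattice \<Longrightarrow> dist (x - y) v \<le> dist (x - y) w"
    using distance_attains_inf[OF closed_int_lattice, of "x - y"] int_lattice_0 by blast
  have "(INF w\<in>int_lattice. norm (x - y - w)) = norm (x - y - v)"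
    using v min by (intro cInf_eq_minimum) (auto simp: dist_norm)
  with v min show ?thesis
    by (auto simp: torus_dist.abs_eq dist_norm)
qed

text \<open>Complex Hilbert spaces on an arbitrary carrier set, so that one can quantify over them.
  Of the ring fields of the module record, \<open>mult\<close> and \<open>one\<close> are irrelevant, as usual.\<close>

definition complex_field :: "complex ring" where
  "complex_field = \<lparr>carrier = UNIV, monoid.mult = (*), one = 1, ring.zero = 0, add = (+)\<rparr>"

record 'u inner_space = "(complex, 'u) module" +
  cinner :: "'u \<Rightarrow> 'u \<Rightarrow> complex"

definition hnorm :: "'u inner_space \<Rightarrow> 'u \<Rightarrow> real" where
  "hnorm H x = sqrt (Re (cinner H x x))"

definition hdist :: "'u inner_space \<Rightarrow> 'u \<Rightarrow> 'u \<Rightarrow> real" where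
  "hdist H x y = hnorm H (x \<ominus>\<^bsub>H\<^esub> y)"

text \<open>By conjugate symmetry \<open>cinner H x x\<close> is real.\<close>

locale complex_hilbert_space = Module.module complex_field H
  for H :: "'u inner_space" (structure) +
  assumes cinner_add: "\<lbrakk>x \<in> carrier H; y \<in> carrier H; z \<in> carrier H\<rbrakk>
      \<Longrightarrow> cinner H (x \<oplus> y) z = cinner H x z + cinner H y z"
    and cinner_smult: "\<lbrakk>x \<in> carrier H; y \<in> carrier H\<rbrakk>
      \<Longrightarrow> cinner H (c \<odot>\<^bsub>H\<^esub> x) y = c * cinner H x y"
    and cinner_commute: "\<lbrakk>x \<in> carrier H; y \<in> carrier H\<rbrakk>
      \<Longrightarrow> cinner H y x = cnj (cinner H x y)"
    and cinner_nonneg: "x \<in> carrier H \<Longrightarrow> 0 \<le> Re (cinner H x x)"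
    and cinner_definite: "\<lbrakk>x \<in> carrier H; cinner H x x = 0\<rbrakk> \<Longrightarrow> x = \<zero>\<^bsub>H\<^esub>"
    and complete: "\<lbrakk>\<And>i. s i \<in> carrier H;
        \<And>e. e > 0 \<Longrightarrow> \<exists>N. \<forall>i\<ge>N. \<forall>j\<ge>N. hdist H (s i) (s j) < e\<rbrakk>
      \<Longrightarrow> \<exists>l\<in>carrier H. (\<lambda>i. hdist H (s i) l) \<longlonglongrightarrow> 0"

text \<open>Distortion of a map from the torus into a space with distance function \<open>d\<close>; it may be
  infinite. For injective maps no denominator vanishes, and both factors are positive.\<close>

definition distortion :: "('b \<Rightarrow> 'b \<Rightarrow> real) \<Rightarrow> ('n::finite torus \<Rightarrow> 'b) \<Rightarrow> ennreal" where
  "distortion d \<phi> =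
     (SUP (x, y)\<in>{(x, y). x \<noteq> y}. ennreal (d (\<phi> x) (\<phi> y) / torus_dist x y)) *
     (SUP (x, y)\<in>{(x, y). x \<noteq> y}. ennreal (torus_dist x y / d (\<phi> x) (\<phi> y)))"

definition euclidean_embedding :: "'u inner_space \<Rightarrow> ('n::finite torus \<Rightarrow> 'u) \<Rightarrow> bool" where
  "euclidean_embedding H \<phi> \<longleftrightarrow> complex_hilbert_space H \<and> inj \<phi> \<and> range \<phi> \<subseteq> carrier H"

text \<open>The infimum ranges over all Hilbert spaces whose carrier is a subset of the type \<open>'u\<close>.
  If \<open>'u\<close> has at least the cardinality of the continuum, this loses nothing: the closed linear
  span of the image of a torus has at most that cardinality, so it can be copied into \<open>'u\<close>.\<close>

definition least_distortion :: "'u itself \<Rightarrow> 'n::finite itself \<Rightarrow> ennreal" where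
  "least_distortion _ _ =
     (INF (H, \<phi>)\<in>{(H :: 'u inner_space, \<phi> :: 'n torus \<Rightarrow> 'u). euclidean_embedding H \<phi>}.
        distortion (hdist H) \<phi>)"

text \<open>$\mathbb{R}^{2n}$ is indexed by \<open>'n \<times> 2\<close>; the coordinates \<open>(k, 1)\<close> and \<open>(k, 2)\<close> hold
  $\cos 2\pi x_k$ and $\sin 2\pi x_k$.\<close>

lift_definition standard_embedding :: "'n::finite torus \<Rightarrow> real^('n \<times> 2)"
  is "\<lambda>x. \<chi> p. if snd p = 1 then cos (2 * pi * x $ fst p) else sin (2 * pi * x $ fst p)"
proof -
  fix x y :: "real^'n"
  assume xy: "lattice_rel x y"
  have "cos (2 * pi * x $ k) = cos (2 * pi * y $ k) \<and> sin (2 * pi * x $ k) = sin (2 * pi * y $ k)" for k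
  proof -
    obtain m :: int where "x $ k - y $ k = of_int m"
      using xy by (auto simp: lattice_rel_def int_lattice_def elim: Ints_cases)
    then have "x $ k = y $ k + of_int m" by linarith
    then have "2 * pi * x $ k = 2 * pi * y $ k + 2 * pi * of_int m"
      by (simp only: distrib_left)
    then show ?thesis
      by (simp only: cos_add sin_add cos_int_2pin sin_int_2pin) simp
  qed
  then show "(\<chi> p. if snd p = (1::2) then cos (2 * pi * x $ fst p) else sin (2 * pi * x $ fst p)) =
      (\<chi> p. if snd p = 1 then cos (2 * pi * y $ fst p) else sin (2 * pi * y $ fst p))"
    by (auto simp: vec_eq_iff)
qed

end

theory Submission
  imports Defs "HOL-Real_Asymp.Real_Asymp"
begin

text \<open>The distortion of the standard embedding is at most $\pi/2$ by a computation in each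
coordinate circle. Two points of the torus have representatives with $|x_k - y_k| \le 1/2$ for
all $k$ that realise their distance, and the distance of their images in the $k$-th circle is
$2 |\sin \pi(x_k - y_k)|$, which lies between $4 |x_k - y_k|$ and $2\pi |x_k - y_k|$. The quotient
of the two constants is $\pi/2$.

No embedding into a Hilbert space does better, already on a coordinate circle
$\mathbb{R}/\mathbb{Z}$. There the distances between antipodal points are $1/2$, and the claim is that
a closed curve $f$ of period $1$ and speed at most $b$ cannot have all antipodal distances
$\|f(t + 1/2) - f(t)\|$ greater than $b/\pi$ (\<open>closed_curve_antipodal_bound\<close>). In the limit
this is Wirtinger's inequality for the function $g(t) = f(t + 1/2) - f(t)$, which satisfies
$g(t + 1/2) = -g(t)$ and so has no Fourier modes of frequency below $2\pi$. Its discrete version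
(\<open>antiperiodic_wirtinger\<close>) avoids integrals and Fourier analysis in the abstract Hilbert space:
for $2^n$ samples, it follows from the bound $R(1) \le \cos(\pi/2^n) R(0)$ on the autocorrelation of
an antiperiodic sequence, which comes from repeated halving of the shift and the half-angle formula
(\<open>antiperiodic_correlation_le\<close>).

The infimum in the least distortion ranges over complex Hilbert spaces on subsets of a given type,
while the standard embedding maps into a real space. For the comparison, $\mathbb{R}^m$ is first
placed isometrically in a copy of $\mathbb{C}^m$ in that type, which exists as the type has at
least the cardinality of the continuum
(\<open>real_euclidean_space_into_complex_hilbert_space\<close>).\<close>

section \<open>Complex Euclidean spaces on a carrier of size at least the continuum\<close>

text \<open>A point of a $T_0$ space is determined by the set of basic open sets that contain it,
hence, when the basis is countable, by a set of natural numbers.\<close>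

lemma second_countable_lepoll_real:
  "(UNIV :: 'a::{second_countable_topology, t0_space} set) \<lesssim> (UNIV :: real set)"
proof -
  obtain B :: "'a set set" where B: "countable B" "topological_basis B"
    using ex_countable_basis by blast
  define code where "code x = {n. x \<in> from_nat_into B n}" for x
  have "inj code"
  proof (rule injI, rule ccontr)
    fix x y :: 'a assume eq: "code x = code y" and "x \<noteq> y"
    then obtain U where U: "open U" "x \<in> U \<longleftrightarrow> y \<notin> U"
      using separation_t0[of x y] by blast
    then obtain b where b: "b \<in> B" "x \<in> b \<longleftrightarrow> y \<notin> b"
      using topological_basisE[OF B(2) U(1)] by (metis subsetD)
    obtain n where "from_nat_into B n = b"
      using from_nat_into_surj[OF B(1) b(1)] by blast
    with b have "n \<in> code x \<longleftrightarrow> n \<notin> code y"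
      by (simp add: code_def)
    with eq show False by simp
  qed
  then have "(UNIV :: 'a set) \<lesssim> (UNIV :: nat set set)"
    unfolding lepoll_def by blast
  then show ?thesis
    using nat_sets_eqpoll_reals lepoll_trans2 by blast
qed

text \<open>The Hermitian space $\mathbb{C}^m$ transported along an injection
\<open>e\<close>.\<close>

definition copied_space :: "(complex^'m \<Rightarrow> 'u) \<Rightarrow> 'u inner_space" where
  "copied_space e =
    \<lparr>carrier = range e, monoid.mult = undefined, one = undefined, ring.zero = e 0,
     add = \<lambda>u v. e (the_inv e u + the_inv e v), smult = \<lambda>c u. e (c *s the_inv e u),
     cinner = \<lambda>u v. \<Sum>k\<in>UNIV. the_inv e u $ k * cnj (the_inv e v $ k)\<rparr>"

lemma copied_space_simps:
  assumes "inj e"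
  shows "carrier (copied_space e) = range e"
    and "\<zero>\<^bsub>copied_space e\<^esub> = e 0"
    and "e x \<oplus>\<^bsub>copied_space e\<^esub> e y = e (x + y)"
    and "c \<odot>\<^bsub>copied_space e\<^esub> e x = e (c *s x)"
    and "cinner (copied_space e) (e x) (e y) = (\<Sum>k\<in>UNIV. x $ k * cnj (y $ k))"
  using assms by (simp_all add: copied_space_def the_inv_f_f)

lemma cring_complex_field: "cring complex_field"
proof (intro cringI abelian_groupI comm_monoidI)
  fix x assume "x \<in> carrier complex_field"
  show "\<exists>y\<in>carrier complex_field. y \<oplus>\<^bsub>complex_field\<^esub> x = \<zero>\<^bsub>complex_field\<^esub>"
    by (auto simp: complex_field_def intro: exI[of _ "- x"])
qed (auto simp: complex_field_def algebra_simps)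

lemma abelian_group_copied_space:
  assumes "inj e"
  shows "abelian_group (copied_space e)"
proof (intro abelian_groupI)
  fix u assume "u \<in> carrier (copied_space e)"
  then obtain x where "u = e x"
    using copied_space_simps(1)[OF assms] by auto
  then have "e (- x) \<oplus>\<^bsub>copied_space e\<^esub> u = \<zero>\<^bsub>copied_space e\<^esub>"
    by (simp add: copied_space_simps[OF assms])
  then show "\<exists>v\<in>carrier (copied_space e). v \<oplus>\<^bsub>copied_space e\<^esub> u = \<zero>\<^bsub>copied_space e\<^esub>"
    using copied_space_simps(1)[OF assms] by blast
qed (auto simp: copied_space_simps[OF assms] algebra_simps)

lemma sum_mult_cnj_eq_norm:
  fixes x :: "complex^'m"
  shows "(\<Sum>k\<in>UNIV. x $ k * cnj (x $ k)) = complex_of_real ((norm x)\<^sup>2)"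
  by (simp add: norm_vec_def L2_set_def sum_nonneg flip: complex_norm_square)

lemma hdist_copied_space:
  assumes "inj e"
  shows "hdist (copied_space e) (e x) (e y) = dist x y"
proof -
  interpret M: abelian_group "copied_space e"
    by (rule abelian_group_copied_space[OF assms])
  note s = copied_space_simps[OF assms]
  have "\<ominus>\<^bsub>copied_space e\<^esub> e y = e (- y)"
    by (rule M.minus_equality) (auto simp: s)
  then have "e x \<ominus>\<^bsub>copied_space e\<^esub> e y = e (x - y)"
    by (simp add: a_minus_def s)
  then show ?thesis
    by (simp only: hdist_def hnorm_def s sum_mult_cnj_eq_norm Re_complex_of_real dist_norm
        real_sqrt_abs abs_norm_cancel)
qed

lemma complex_hilbert_space_copied_space:
  fixes e :: "complex^'m \<Rightarrow> 'u"
  assumes "inj e"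
  shows "complex_hilbert_space (copied_space e)"
proof -
  note s = copied_space_simps[OF assms]
  have "Module.module complex_field (copied_space e)"
    by (intro module.intro cring_complex_field abelian_group_copied_space assms module_axioms.intro)
      (auto simp: s complex_field_def vec.scale_left_distrib vec.scale_right_distrib)
  moreover have "complex_hilbert_space_axioms (copied_space e)"
  proof
    fix u assume "u \<in> carrier (copied_space e)" and "cinner (copied_space e) u u = 0"
    then obtain x where x: "u = e x" and "(\<Sum>k\<in>UNIV. x $ k * cnj (x $ k)) = 0"
      by (auto simp: s)
    then have "x = 0"
      by (simp only: sum_mult_cnj_eq_norm) simp
    then show "u = \<zero>\<^bsub>copied_space e\<^esub>"
      by (simp add: s x)
  next
    fix u :: "nat \<Rightarrow> 'u"
    assume "\<And>i. u i \<in> carrier (copied_space e)"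
      and cauchy: "\<And>r. r > 0 \<Longrightarrow> \<exists>N. \<forall>i\<ge>N. \<forall>j\<ge>N. hdist (copied_space e) (u i) (u j) < r"
    then have u: "u i = e (the_inv e (u i))" for i
      using assms by (simp add: s f_the_inv_into_f)
    define x where "x i = the_inv e (u i)" for i
    note u = u[folded x_def]
    have "Cauchy x"
      using cauchy unfolding u Cauchy_def hdist_copied_space[OF assms] by blast
    then obtain l where "x \<longlonglongrightarrow> l"
      using Cauchy_convergent_iff convergent_def by blast
    then have "(\<lambda>i. hdist (copied_space e) (u i) (e l)) \<longlonglongrightarrow> 0"
      unfolding u hdist_copied_space[OF assms] by (subst tendsto_dist_iff[symmetric])
    then show "\<exists>l\<in>carrier (copied_space e). (\<lambda>i. hdist (copied_space e) (u i) l) \<longlonglongrightarrow> 0"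
      by (auto simp: s)
  qed (auto simp: s sum.distrib algebra_simps sum_distrib_left Re_sum intro!: add_nonneg_nonneg sum_nonneg)
  ultimately show ?thesis
    by (rule complex_hilbert_space.intro)
qed

text \<open>This turns a map into a real Euclidean space, such as the standard embedding, into a
competitor for the least distortion: $\mathbb{R}^m \subseteq \mathbb{C}^m$ isometrically, and
$\mathbb{C}^m$ has the cardinality of the continuum.\<close>

lemma real_euclidean_space_into_complex_hilbert_space:
  assumes "(UNIV :: real set) \<lesssim> (UNIV :: 'u set)"
  obtains H :: "'u inner_space" and J :: "real^'m \<Rightarrow> 'u"
  where "complex_hilbert_space H" "range J \<subseteq> carrier H" "inj J"
    "\<And>x y. hdist H (J x) (J y) = dist x y"
proof -
  have "(UNIV :: (complex^'m) set) \<lesssim> (UNIV :: 'u set)"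
    using second_countable_lepoll_real assms by (rule lepoll_trans)
  then obtain e :: "complex^'m \<Rightarrow> 'u" where e: "inj e"
    unfolding lepoll_def by blast
  define J :: "real^'m \<Rightarrow> 'u" where "J x = e (\<chi> k. complex_of_real (x $ k))" for x
  have "hdist (copied_space e) (J x) (J y) = dist x y" for x y
  proof -
    have "norm (complex_of_real (x $ k) - complex_of_real (y $ k)) = norm (x $ k - y $ k)" for k
      by (metis norm_of_real of_real_diff real_norm_def)
    then show ?thesis
      by (simp add: J_def hdist_copied_space[OF e] dist_norm norm_vec_def)
  qed
  moreover have "inj J"
    by (rule injI) (use e in \<open>auto simp: J_def inj_eq vec_eq_iff\<close>)
  moreover have "range J \<subseteq> carrier (copied_space e)"
    by (auto simp: J_def copied_space_simps[OF e])
  ultimately show thesis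
    using that[of "copied_space e" J] complex_hilbert_space_copied_space[OF e] by blast
qed

section \<open>Shortest representatives in the torus\<close>

lemma abs_torus_eq_iff: "abs_torus x = abs_torus y \<longleftrightarrow> x - y \<in> int_lattice"
  by (simp add: torus.abs_eq_iff lattice_rel_def)

text \<open>If $v$ is a lattice vector nearest to $x - y$, then replacing $v$ by $v \pm e_k$ does
not bring it closer. Comparing the squared norms, this says that the $k$-th coordinate of $x - y -
v$ is at most $1/2$ in absolute value.\<close>

lemma torus_shortest_representatives:
  obtains x y where "p = abs_torus x" "q = abs_torus y" "torus_dist p q = norm (x - y)"
    "\<And>k. \<bar>x $ k - y $ k\<bar> \<le> 1 / 2"
proof -
  obtain x y where p: "p = abs_torus x" and q: "q = abs_torus y"
    using torus.abs_induct[of "\<lambda>p. \<exists>x. p = abs_torus x"] by blast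
  obtain v where v: "v \<in> int_lattice" and d: "torus_dist p q = norm (x - y - v)"
    and min: "\<And>w. w \<in> int_lattice \<Longrightarrow> norm (x - y - v) \<le> norm (x - y - w)"
    using torus_dist_attained[of x y] p q by blast
  have half: "c * (x - y - v) $ k \<le> 1 / 2" if c: "c \<in> {1, -1}" for c k
  proof -
    define z where "z = x - y - v"
    have "v + axis k c \<in> int_lattice"
      using v c by (intro int_lattice_add) (auto simp: int_lattice_def axis_def)
    from min[OF this] have "norm z \<le> norm (z - axis k c)"
      by (simp add: z_def algebra_simps)
    then have "z \<bullet> z \<le> (z - axis k c) \<bullet> (z - axis k c)"
      by (simp add: norm_le)
    also have "\<dots> = z \<bullet> z - 2 * (c * z $ k) + c * c"
      by (simp add: inner_diff inner_axis inner_axis' algebra_simps)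
    finally show ?thesis
      using c by (auto simp: z_def)
  qed
  show thesis
  proof (rule that[of "x - v" y])
    show "p = abs_torus (x - v)"
      using v by (simp add: p abs_torus_eq_iff)
    show "\<bar>(x - v) $ k - y $ k\<bar> \<le> 1 / 2" for k
      using half[of 1 k] half[of "-1" k] by (intro abs_leI) simp_all
  qed (use q d in \<open>simp_all add: algebra_simps\<close>)
qed

lemma torus_dist_pos:
  assumes "p \<noteq> q" shows "torus_dist p q > 0"
  by (rule torus_shortest_representatives[of p q]) (use assms in auto)

lemma torus_dist_le_norm: "torus_dist (abs_torus x) (abs_torus y) \<le> norm (x - y)"
  using torus_dist_attained[of x y] int_lattice_0 by force

text \<open>Every integer is at distance at least $1/2$ from $1/2$.\<close>

lemma torus_dist_antipodal:
  "torus_dist (abs_torus (axis k (t + 1 / 2))) (abs_torus (axis k t)) \<ge> 1 / 2"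
proof -
  obtain v where v: "v \<in> int_lattice" and d: "torus_dist (abs_torus (axis k (t + 1 / 2)))
      (abs_torus (axis k t)) = norm (axis k (t + 1 / 2) - axis k t - v)"
    using torus_dist_attained by blast
  obtain m :: int where m: "v $ k = of_int m"
    using v by (auto simp: int_lattice_def elim: Ints_cases)
  have "1 / 2 \<le> \<bar>1 / 2 - real_of_int m\<bar>"
    by (cases "m \<le> 0") auto
  also have "\<dots> = norm ((axis k (t + 1 / 2) - axis k t - v) $ k)"
    by (simp add: m)
  also have "\<dots> \<le> norm (axis k (t + 1 / 2) - axis k t - v)"
    by (rule Finite_Cartesian_Product.norm_nth_le)
  finally show ?thesis by (simp add: d)
qed

section \<open>The standard embedding\<close>

text \<open>Jordan's inequality: the sine is concave on $[0, \pi/2]$, so there its graph lies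
above the chord from the origin to $(\pi/2, 1)$.\<close>

lemma jordan_inequality:
  assumes "0 \<le> x" "x \<le> pi / 2"
  shows "2 / pi * x \<le> sin x"
proof -
  have "convex_on {0..pi / 2} (\<lambda>x. - sin x)"
  proof (rule f''_ge0_imp_convex)
    show "((\<lambda>x. - sin x) has_real_derivative - cos x) (at x)" for x :: real
      by (auto intro!: derivative_eq_intros)
    show "((\<lambda>x. - cos x) has_real_derivative sin x) (at x)" for x :: real
      by (auto intro!: derivative_eq_intros)
    show "0 \<le> sin x" if "x \<in> {0..pi / 2}" for x
      using that by (intro sin_ge_zero) auto
  qed auto
  from convex_onD[OF this, of "2 / pi * x" 0 "pi / 2"] assms show ?thesis
    by (simp add: field_simps)
qed

text \<open>In each coordinate circle the embedding maps two points at angle $2\pi t$ to the ends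
of a chord of length $2 |\sin \pi t|$.\<close>

lemma dist_standard_embedding:
  "(dist (standard_embedding (abs_torus x)) (standard_embedding (abs_torus y)))\<^sup>2
    = (\<Sum>k\<in>UNIV. (2 * sin (pi * (x $ k - y $ k)))\<^sup>2)"
proof -
  have chord: "(cos (2 * a) - cos (2 * b))\<^sup>2 + (sin (2 * a) - sin (2 * b))\<^sup>2
      = (2 * sin (a - b))\<^sup>2" for a b :: real
  proof -
    have "(cos (2 * a) - cos (2 * b))\<^sup>2 + (sin (2 * a) - sin (2 * b))\<^sup>2
        = ((sin (2 * a))\<^sup>2 + (cos (2 * a))\<^sup>2) + ((sin (2 * b))\<^sup>2 + (cos (2 * b))\<^sup>2)
          - 2 * (cos (2 * a) * cos (2 * b) + sin (2 * a) * sin (2 * b))"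
      by (simp only: power2_eq_square algebra_simps)
    also have "\<dots> = 2 - 2 * cos (2 * a - 2 * b)"
      by (simp only: sin_cos_squared_add cos_diff)
    also have "\<dots> = (2 * sin (a - b))\<^sup>2"
      using cos_double_sin[of "a - b"] by (simp add: right_diff_distrib power_mult_distrib)
    finally show ?thesis .
  qed
  have "(dist (standard_embedding (abs_torus x)) (standard_embedding (abs_torus y)))\<^sup>2
      = (\<Sum>p\<in>UNIV. (dist (standard_embedding (abs_torus x) $ p) (standard_embedding (abs_torus y) $ p))\<^sup>2)"
    by (simp add: dist_vec_def L2_set_def sum_nonneg)
  also have "\<dots> = (\<Sum>k\<in>UNIV. \<Sum>j\<in>UNIV. (dist (standard_embedding (abs_torus x) $ (k, j))
      (standard_embedding (abs_torus y) $ (k, j)))\<^sup>2)"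
    by (simp add: sum.cartesian_product flip: UNIV_Times_UNIV)
  also have "\<dots> = (\<Sum>k\<in>UNIV. (2 * sin (pi * (x $ k - y $ k)))\<^sup>2)"
    using chord[of "pi * x $ k" "pi * y $ k" for k]
    by (simp add: standard_embedding.abs_eq sum_2 dist_real_def algebra_simps)
  finally show ?thesis .
qed

text \<open>For shortest representatives, the bounds $4 |t| \le 2 |\sin \pi t| \le 2 \pi |t|$ hold
in every coordinate, the lower one because $|t| \le 1/2$.\<close>

lemma standard_embedding_bounds:
  shows "4 * torus_dist p q \<le> dist (standard_embedding p) (standard_embedding q)"
    and "dist (standard_embedding p) (standard_embedding q) \<le> 2 * pi * torus_dist p q"
proof -
  obtain x y where xy: "p = abs_torus x" "q = abs_torus y" and d: "torus_dist p q = norm (x - y)"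
    and half: "\<And>k. \<bar>x $ k - y $ k\<bar> \<le> 1 / 2"
    using torus_shortest_representatives by blast
  have low: "(4 * (x $ k - y $ k))\<^sup>2 \<le> (2 * sin (pi * (x $ k - y $ k)))\<^sup>2" for k
  proof -
    define z where "z = x $ k - y $ k"
    have "2 / pi * (pi * \<bar>z\<bar>) \<le> sin (pi * \<bar>z\<bar>)"
      using half[of k] by (intro jordan_inequality) (auto simp: z_def)
    also have "sin (pi * \<bar>z\<bar>) \<le> \<bar>sin (pi * z)\<bar>"
      by (cases "z \<ge> 0") auto
    finally have "\<bar>4 * z\<bar> \<le> \<bar>2 * sin (pi * z)\<bar>"
      by (simp add: abs_mult)
    then show ?thesis
      by (simp only: abs_le_square_iff z_def)
  qed
  have up: "(2 * sin (pi * (x $ k - y $ k)))\<^sup>2 \<le> (2 * pi * (x $ k - y $ k))\<^sup>2" for k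
    using abs_sin_x_le_abs_x[of "pi * (x $ k - y $ k)"]
    unfolding abs_le_square_iff[symmetric] by (simp add: abs_mult)
  have n: "(c * norm (x - y))\<^sup>2 = (\<Sum>k\<in>UNIV. (c * (x $ k - y $ k))\<^sup>2)" for c
    by (simp add: power_mult_distrib norm_vec_def L2_set_def sum_nonneg sum_distrib_left)
  show "4 * torus_dist p q \<le> dist (standard_embedding p) (standard_embedding q)"
    unfolding xy dist_standard_embedding n d[unfolded xy]
    by (rule power2_le_imp_le) (simp_all only: dist_standard_embedding n zero_le_dist sum_mono low)
  show "dist (standard_embedding p) (standard_embedding q) \<le> 2 * pi * torus_dist p q"
    unfolding xy dist_standard_embedding n d[unfolded xy]
    by (rule power2_le_imp_le) (simp_all only: dist_standard_embedding n sum_mono up, simp)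
qed

lemma inj_standard_embedding: "inj standard_embedding"
proof (rule injI, rule ccontr)
  fix p q :: "'a torus" assume "standard_embedding p = standard_embedding q" "p \<noteq> q"
  then show False
    using standard_embedding_bounds(1)[of p q] torus_dist_pos[of p q] by simp
qed

lemma distortion_standard_embedding_le:
  "distortion dist (standard_embedding :: 'n::finite torus \<Rightarrow> _) \<le> ennreal (pi / 2)"
proof -
  have "distortion dist (standard_embedding :: 'n torus \<Rightarrow> _) \<le> ennreal (2 * pi) * ennreal (1 / 4)"
    unfolding distortion_def
  proof (intro mult_mono SUP_least zero_le; clarify?)
    fix p q :: "'n torus" assume "p \<noteq> q"
    then have pos: "torus_dist p q > 0"
      by (rule torus_dist_pos)
    note b = standard_embedding_bounds[of p q]
    show "ennreal (dist (standard_embedding p) (standard_embedding q) / torus_dist p q) \<le> ennreal (2 * pi)"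
      using b pos by (intro ennreal_leI) (simp add: divide_le_eq)
    show "ennreal (torus_dist p q / dist (standard_embedding p) (standard_embedding q)) \<le> ennreal (1 / 4)"
      using b pos by (intro ennreal_leI) (simp add: divide_le_eq)
  qed
  also have "\<dots> = ennreal (pi / 2)"
    by (simp flip: ennreal_mult)
  finally show ?thesis .
qed

section \<open>A discrete Wirtinger inequality in Hilbert space\<close>

lemma sum_shift_periodic:
  fixes h :: "nat \<Rightarrow> 'a::ab_group_add"
  assumes "\<And>i. h (i + m) = h i"
  shows "(\<Sum>i<m. h (i + t)) = (\<Sum>i<m. h i)"
proof (induction t)
  case (Suc t)
  have "(\<Sum>i<m. h (i + Suc t)) + h t = (\<Sum>i<Suc m. h (i + t))"
    by (simp only: sum.lessThan_Suc_shift) (simp add: add.commute)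
  also have "\<dots> = (\<Sum>i<m. h (i + t)) + h t"
    using assms[of t] by (simp add: add.commute)
  finally show ?case
    using Suc by simp
qed simp

context complex_hilbert_space
begin

abbreviation rinner (infix "\<bullet>\<^sub>H" 70) where
  "x \<bullet>\<^sub>H y \<equiv> Re (cinner H x y)"

lemma rinner_commute: "\<lbrakk>x \<in> carrier H; y \<in> carrier H\<rbrakk> \<Longrightarrow> x \<bullet>\<^sub>H y = y \<bullet>\<^sub>H x"
  by (subst cinner_commute) simp_all

lemma rinner_add_left:
  "\<lbrakk>x \<in> carrier H; y \<in> carrier H; z \<in> carrier H\<rbrakk> \<Longrightarrow> (x \<oplus> y) \<bullet>\<^sub>H z = x \<bullet>\<^sub>H z + y \<bullet>\<^sub>H z"
  by (simp add: cinner_add)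

lemma rinner_add_right:
  "\<lbrakk>x \<in> carrier H; y \<in> carrier H; z \<in> carrier H\<rbrakk> \<Longrightarrow> x \<bullet>\<^sub>H (y \<oplus> z) = x \<bullet>\<^sub>H y + x \<bullet>\<^sub>H z"
  by (metis rinner_add_left rinner_commute M.add.m_closed)

lemma rinner_minus_left:
  assumes "x \<in> carrier H" "y \<in> carrier H"
  shows "(\<ominus> x) \<bullet>\<^sub>H y = - (x \<bullet>\<^sub>H y)"
proof -
  have "\<zero> \<bullet>\<^sub>H y = 0"
    using rinner_add_left[of "\<zero>" "\<zero>" y] assms by simp
  then show ?thesis
    using rinner_add_left[of x "\<ominus> x" y] assms by (simp add: M.r_neg)
qed

lemma rinner_minus_right:
  "\<lbrakk>x \<in> carrier H; y \<in> carrier H\<rbrakk> \<Longrightarrow> x \<bullet>\<^sub>H (\<ominus> y) = - (x \<bullet>\<^sub>H y)"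
  by (metis rinner_minus_left rinner_commute M.add.inv_closed)

lemma rscale_closed: "x \<in> carrier H \<Longrightarrow> complex_of_real c \<odot>\<^bsub>H\<^esub> x \<in> carrier H"
  by (rule smult_closed) (simp_all add: complex_field_def)

lemma rinner_scale_left:
  "\<lbrakk>x \<in> carrier H; y \<in> carrier H\<rbrakk> \<Longrightarrow> (complex_of_real c \<odot>\<^bsub>H\<^esub> x) \<bullet>\<^sub>H y = c * (x \<bullet>\<^sub>H y)"
  by (simp add: cinner_smult)

lemma rinner_scale_right:
  "\<lbrakk>x \<in> carrier H; y \<in> carrier H\<rbrakk> \<Longrightarrow> x \<bullet>\<^sub>H (complex_of_real c \<odot>\<^bsub>H\<^esub> y) = c * (x \<bullet>\<^sub>H y)"
  by (metis rinner_scale_left rinner_commute rscale_closed)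

lemmas rinner_bilinear =
  rinner_add_left rinner_add_right rinner_minus_left rinner_minus_right
  rinner_scale_left rinner_scale_right rscale_closed

lemma hdist_power2:
  assumes "x \<in> carrier H" "y \<in> carrier H"
  shows "(hdist H x y)\<^sup>2 = x \<bullet>\<^sub>H x - 2 * (x \<bullet>\<^sub>H y) + y \<bullet>\<^sub>H y"
proof -
  have "(hdist H x y)\<^sup>2 = (x \<ominus> y) \<bullet>\<^sub>H (x \<ominus> y)"
    using assms by (simp add: hdist_def hnorm_def cinner_nonneg)
  then show ?thesis
    using assms rinner_commute[of x y] by (simp add: a_minus_def rinner_bilinear)
qed

lemma hdist_nonneg: "\<lbrakk>x \<in> carrier H; y \<in> carrier H\<rbrakk> \<Longrightarrow> 0 \<le> hdist H x y"
  by (simp add: hdist_def hnorm_def cinner_nonneg)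

lemma hdist_self: "x \<in> carrier H \<Longrightarrow> hdist H x x = 0"
  using hdist_power2[of x x] by simp

lemma hdist_pos:
  assumes "x \<in> carrier H" "y \<in> carrier H" "x \<noteq> y"
  shows "hdist H x y > 0"
proof (rule ccontr)
  assume "\<not> ?thesis"
  with assms have "hdist H x y = 0"
    using hdist_nonneg[of x y] by linarith
  then have "Re (cinner H (x \<ominus> y) (x \<ominus> y)) = 0"
    using assms by (simp add: hdist_def hnorm_def)
  moreover
  have "Im (cinner H (x \<ominus> y) (x \<ominus> y)) = 0"
    using arg_cong[OF cinner_commute[of "x \<ominus> y" "x \<ominus> y"], of Im] assms by simp
  ultimately
  have "x \<ominus> y = \<zero>"
    using assms by (intro cinner_definite) (auto simp: complex_eq_iff)
  have "x = (x \<ominus> y) \<oplus> y"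
    using assms by (simp add: a_minus_def M.a_assoc M.l_neg)
  also have "\<dots> = y"
    using \<open>x \<ominus> y = \<zero>\<close> assms by simp
  finally show False
    using assms by simp
qed

text \<open>The parallelogram law for $u - x$ and $v - y$, with one of the diagonals
dropped.\<close>

lemma hdist_difference_power2_le:
  assumes "u \<in> carrier H" "v \<in> carrier H" "x \<in> carrier H" "y \<in> carrier H"
  shows "(hdist H (u \<ominus> v) (x \<ominus> y))\<^sup>2 \<le> 2 * (hdist H u x)\<^sup>2 + 2 * (hdist H v y)\<^sup>2"
proof -
  let ?w = "(u \<ominus> x) \<oplus> (v \<ominus> y)"
  have "0 \<le> ?w \<bullet>\<^sub>H ?w"
    by (intro cinner_nonneg M.add.m_closed M.minus_closed assms)
  moreover note commute = rinner_commute[OF assms(2,1)] rinner_commute[OF assms(3,1)]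
    rinner_commute[OF assms(4,1)] rinner_commute[OF assms(3,2)] rinner_commute[OF assms(4,2)]
    rinner_commute[OF assms(4,3)]
  ultimately show ?thesis
    by (simp only: hdist_power2 rinner_bilinear a_minus_def assms M.add.m_closed M.add.inv_closed
        commute) (simp add: algebra_simps)
qed

text \<open>This is $\|x + z - 2 c y\|^2 \ge 0$. Equality holds when $x$, $y$, $z$ are consecutive
terms of a rotation by the angle $\theta$ with $c = \cos \theta$, so nothing is lost on regular
polygons.\<close>

lemma rinner_three_term_le:
  assumes "x \<in> carrier H" "y \<in> carrier H" "z \<in> carrier H"
  shows "4 * c * (x \<bullet>\<^sub>H y + y \<bullet>\<^sub>H z)
    \<le> x \<bullet>\<^sub>H x + z \<bullet>\<^sub>H z + 2 * (x \<bullet>\<^sub>H z) + 4 * c\<^sup>2 * (y \<bullet>\<^sub>H y)"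
proof -
  let ?w = "(x \<oplus> z) \<oplus> (complex_of_real (- 2 * c) \<odot>\<^bsub>H\<^esub> y)"
  have "0 \<le> ?w \<bullet>\<^sub>H ?w"
    using assms by (intro cinner_nonneg M.add.m_closed rscale_closed)
  also have "?w \<bullet>\<^sub>H ?w = x \<bullet>\<^sub>H x + z \<bullet>\<^sub>H z + 2 * (x \<bullet>\<^sub>H z) + 4 * c\<^sup>2 * (y \<bullet>\<^sub>H y)
      - 4 * c * (x \<bullet>\<^sub>H y + y \<bullet>\<^sub>H z)"
    using rinner_commute[OF assms(2,1)] rinner_commute[OF assms(3,1)] rinner_commute[OF assms(3,2)]
    by (simp only: rinner_bilinear assms M.add.m_closed) (simp add: algebra_simps power2_eq_square)
  finally show ?thesis
    by simp
qed

text \<open>Let $R(s) = \sum_i \langle g_i, g_{i+s} \rangle$ and $m = 2^n$. Summing the previous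
inequality over all triples $(g_i, g_{i+s}, g_{i+2s})$ gives $8 c R(s) \le 2 R(0) + 2 R(2s) + 4
c^2 R(0)$. Hence, if $R(2s) \le \cos(2\theta) R(0) = (2 c^2 - 1) R(0)$ with $c = \cos\theta > 0$,
then $R(s) \le \cos(\theta) R(0)$. Antiperiodicity gives $R(m/2) = 0 = \cos(\pi/2) R(0)$, and
halving the shift $n - 1$ times leads to $R(1) \le \cos(\pi/m) R(0)$. This replaces the discrete
Fourier transform, and it is the reason for taking $m$ to be a power of two.\<close>

lemma antiperiodic_correlation_le:
  fixes g :: "nat \<Rightarrow> 'u"
  assumes g: "\<And>i. g i \<in> carrier H" and anti: "\<And>i. g (i + 2 ^ n) = \<ominus> g i" and "n \<ge> 1"
  shows "(\<Sum>i<2 ^ n. g i \<bullet>\<^sub>H g (i + 1)) \<le> cos (pi / 2 ^ n) * (\<Sum>i<2 ^ n. g i \<bullet>\<^sub>H g i)"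
proof -
  define m :: nat where "m = 2 ^ n"
  define R where "R s = (\<Sum>i<m. g i \<bullet>\<^sub>H g (i + s))" for s
  have shift: "(\<Sum>i<m. g (i + t) \<bullet>\<^sub>H g (i + t + s)) = R s" for s t
    unfolding R_def
  proof (rule sum_shift_periodic[where h = "\<lambda>i. g i \<bullet>\<^sub>H g (i + s)"])
    fix i
    have "g (i + m) = \<ominus> g i"
      unfolding m_def by (rule anti)
    moreover have "g (i + m + s) = \<ominus> g (i + s)"
      unfolding m_def using anti[of "i + s"] by (simp only: add.assoc add.commute[of s])
    ultimately show "g (i + m) \<bullet>\<^sub>H g (i + m + s) = g i \<bullet>\<^sub>H g (i + s)"
      by (simp only: rinner_minus_left rinner_minus_right g M.add.inv_closed minus_minus)
  qed
  have halving: "8 * c * R s \<le> 2 * R 0 + 2 * R (2 * s) + 4 * c\<^sup>2 * R 0" for c s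
  proof -
    have "(\<Sum>i<m. 4 * c * (g i \<bullet>\<^sub>H g (i + s) + g (i + s) \<bullet>\<^sub>H g (i + 2 * s)))
      \<le> (\<Sum>i<m. g i \<bullet>\<^sub>H g i + g (i + 2 * s) \<bullet>\<^sub>H g (i + 2 * s) + 2 * (g i \<bullet>\<^sub>H g (i + 2 * s))
          + 4 * c\<^sup>2 * (g (i + s) \<bullet>\<^sub>H g (i + s)))"
      by (intro sum_mono rinner_three_term_le g)
    moreover have "(\<Sum>i<m. g (i + s) \<bullet>\<^sub>H g (i + 2 * s)) = R s"
      using shift[of s s] by (simp add: mult_2 add.assoc)
    moreover have "(\<Sum>i<m. g i \<bullet>\<^sub>H g i) = R 0" "(\<Sum>i<m. g (i + s) \<bullet>\<^sub>H g (i + s)) = R 0"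
      "(\<Sum>i<m. g (i + 2 * s) \<bullet>\<^sub>H g (i + 2 * s)) = R 0"
      using shift[of 0 0] shift[of s 0] shift[of "2 * s" 0] by simp_all
    ultimately show ?thesis
      using shift[of 0 s] shift[of 0 "2 * s"]
      by (simp add: sum.distrib flip: sum_distrib_left)
  qed
  have bound: "k < n \<Longrightarrow> R (2 ^ (n - Suc k)) \<le> cos (pi / 2 ^ Suc k) * R 0" for k
  proof (induction k)
    case 0
    \<comment> \<open>Shifting by half of \<open>m\<close> swaps the two factors up to a sign, so \<open>R s = - R s\<close>.\<close>
    define s :: nat where "s = 2 ^ (n - Suc 0)"
    have m: "m = s + s"
      using \<open>n \<ge> 1\<close> by (cases n) (auto simp: m_def s_def)
    have "R s = (\<Sum>i<m. g (i + s) \<bullet>\<^sub>H g (i + m))"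
      using shift[of s s] by (simp add: m add.assoc)
    also have "\<dots> = - R s"
      unfolding R_def m_def by (simp add: anti g rinner_minus_right rinner_commute[of "g (_ + s)"]
          flip: sum_negf)
    finally show ?case
      by (simp add: s_def)
  next
    case (Suc k)
    define c where "c = cos (pi / 2 ^ Suc (Suc k))"
    have "(2::real) ^ 1 < 2 ^ Suc (Suc k)"
      by (rule power_strict_increasing) auto
    then have "pi / 2 ^ Suc (Suc k) < pi / 2"
      by (intro divide_strict_left_mono) auto
    then have c: "c > 0"
      unfolding c_def by (intro cos_gt_zero_pi) (auto intro: less_trans[of _ 0])
    have double: "cos (pi / 2 ^ Suc k) = 2 * c\<^sup>2 - 1"
      unfolding c_def cos_double_cos[symmetric] by simp
    have "2 * 2 ^ (n - Suc (Suc k)) = (2::nat) ^ (n - Suc k)"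
      using Suc.prems by (metis Suc_diff_Suc power_Suc)
    then have "8 * c * R (2 ^ (n - Suc (Suc k)))
        \<le> 2 * R 0 + 2 * ((2 * c\<^sup>2 - 1) * R 0) + 4 * c\<^sup>2 * R 0"
      using halving[of c "2 ^ (n - Suc (Suc k))"] Suc.IH Suc.prems double by simp
    also have "\<dots> = 8 * c * (c * R 0)"
      by (simp add: algebra_simps power2_eq_square)
    finally have "R (2 ^ (n - Suc (Suc k))) \<le> c * R 0"
      using c by simp
    then show ?case
      by (simp only: c_def)
  qed
  show ?thesis
    using bound[of "n - 1"] \<open>n \<ge> 1\<close> by (simp add: R_def m_def)
qed

text \<open>Expanding the squares, the right-hand side is $2 R(0) - 2 R(1)$ for the correlation
$R$ bounded above, and $2 - 2 \cos(\pi/m) = 4 \sin^2(\pi/2m)$.\<close>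

lemma antiperiodic_wirtinger:
  fixes g :: "nat \<Rightarrow> 'u"
  assumes g: "\<And>i. g i \<in> carrier H" and anti: "\<And>i. g (i + 2 ^ n) = \<ominus> g i" and "n \<ge> 1"
  shows "(2 * sin (pi / 2 ^ Suc n))\<^sup>2 * (\<Sum>i<2 ^ n. (hnorm H (g i))\<^sup>2)
    \<le> (\<Sum>i<2 ^ n. (hdist H (g (i + 1)) (g i))\<^sup>2)"
proof -
  have norm: "(hnorm H (g i))\<^sup>2 = g i \<bullet>\<^sub>H g i" for i
    using g by (simp add: hnorm_def cinner_nonneg)
  have "g (i + 2 ^ n) \<bullet>\<^sub>H g (i + 2 ^ n) = g i \<bullet>\<^sub>H g i" for i
    by (simp add: anti rinner_minus_left rinner_minus_right g)
  then have shift: "(\<Sum>i<2 ^ n. g (i + 1) \<bullet>\<^sub>H g (i + 1)) = (\<Sum>i<2 ^ n. g i \<bullet>\<^sub>H g i)"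
    by (rule sum_shift_periodic[where h = "\<lambda>i. g i \<bullet>\<^sub>H g i"])
  have cos: "cos (pi / 2 ^ n) = 1 - 2 * (sin (pi / 2 ^ Suc n))\<^sup>2"
    using cos_double_sin[of "pi / 2 ^ Suc n"] by simp
  have "(2 * sin (pi / 2 ^ Suc n))\<^sup>2 * (\<Sum>i<2 ^ n. g i \<bullet>\<^sub>H g i)
      = 2 * (\<Sum>i<2 ^ n. g i \<bullet>\<^sub>H g i) - 2 * (cos (pi / 2 ^ n) * (\<Sum>i<2 ^ n. g i \<bullet>\<^sub>H g i))"
    unfolding cos by (simp add: power_mult_distrib left_diff_distrib)
  also have "\<dots> \<le> 2 * (\<Sum>i<2 ^ n. g i \<bullet>\<^sub>H g i) - 2 * (\<Sum>i<2 ^ n. g i \<bullet>\<^sub>H g (i + 1))"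
    using antiperiodic_correlation_le[of g n] assms by simp
  also have "\<dots> = (\<Sum>i<2 ^ n. (hdist H (g (i + 1)) (g i))\<^sup>2)"
    using shift rinner_commute[OF g g]
    by (simp add: hdist_power2 g sum.distrib sum_subtractf flip: sum_distrib_left)
  finally show ?thesis
    by (simp add: norm)
qed

text \<open>A closed curve of speed at most $b$ cannot keep its antipodal points farther apart
than a circle of circumference $b$, whose diameter is $b/\pi$. Sample the curve at $2m$ equally
spaced times, with $m = 2^n$. The $m$ differences of antipodal samples form an antiperiodic
sequence with terms of norm at least $a$ and steps of length at most $2 \cdot b/2m$, since both of
its ends move by at most $b/2m$. The Wirtinger inequality gives $2 m \sin(\pi/2m) \, a \le b$, and
$m \to \infty$ finishes the proof.\<close>

lemma closed_curve_antipodal_bound: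
  fixes f :: "real \<Rightarrow> 'u"
  assumes f: "\<And>t. f t \<in> carrier H" and period: "\<And>t. f (t + 1) = f t"
    and lip: "\<And>s t. hdist H (f s) (f t) \<le> b * \<bar>s - t\<bar>"
    and far: "\<And>t. a \<le> hdist H (f (t + 1 / 2)) (f t)" and "a \<ge> 0"
  shows "pi * a \<le> b"
proof -
  have "b \<ge> 0"
    using lip[of 1 0] hdist_nonneg[OF f f, of 1 0] by simp
  have step: "2 ^ Suc n * sin (pi / 2 ^ Suc n) * a \<le> b" if "n \<ge> 1" for n
  proof -
    define m :: nat where "m = 2 ^ n"
    have m: "m > 0"
      by (simp add: m_def)
    define g where "g i = f (real i / (2 * m) + 1 / 2) \<ominus> f (real i / (2 * m))" for i
    have g: "g i \<in> carrier H" for i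
      by (simp add: g_def f)
    have "g (i + 2 ^ n) = \<ominus> g i" for i
    proof -
      have "real (i + m) / (2 * m) = real i / (2 * m) + 1 / 2"
        using m by (simp add: field_simps)
      moreover have "real i / (2 * m) + 1 / 2 + 1 / 2 = real i / (2 * m) + 1"
        by simp
      ultimately have "g (i + m) = f (real i / (2 * m)) \<ominus> f (real i / (2 * m) + 1 / 2)"
        unfolding g_def by (simp only: period)
      then show ?thesis
        by (simp add: m_def[symmetric] g_def f a_minus_def M.minus_add M.add.m_comm)
    qed
    then have W: "(2 * sin (pi / 2 ^ Suc n))\<^sup>2 * (\<Sum>i<m. (hnorm H (g i))\<^sup>2)
        \<le> (\<Sum>i<m. (hdist H (g (i + 1)) (g i))\<^sup>2)"
      unfolding m_def using g that by (intro antiperiodic_wirtinger)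
    have "(hdist H (g (i + 1)) (g i))\<^sup>2 \<le> (b / m)\<^sup>2" for i
    proof -
      have L: "(hdist H (f (real (i + 1) / (2 * m) + c)) (f (real i / (2 * m) + c)))\<^sup>2
          \<le> (b / (2 * m))\<^sup>2" for c
      proof -
        have "hdist H (f (real (i + 1) / (2 * m) + c)) (f (real i / (2 * m) + c))
            \<le> b * \<bar>1 / (2 * real m)\<bar>"
          using lip[of "real (i + 1) / (2 * m) + c" "real i / (2 * m) + c"]
          by (simp add: add_divide_distrib)
        then show ?thesis
          by (intro power_mono hdist_nonneg f) simp
      qed
      have "(hdist H (g (i + 1)) (g i))\<^sup>2 \<le> 2 * (b / (2 * m))\<^sup>2 + 2 * (b / (2 * m))\<^sup>2"
        unfolding g_def
        by (rule order_trans[OF hdist_difference_power2_le[OF f f f f]])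
           (use L[of "1 / 2"] L[of 0] in simp)
      then show ?thesis
        by (simp add: power_divide power_mult_distrib)
    qed
    then have "(\<Sum>i<m. (hdist H (g (i + 1)) (g i))\<^sup>2) \<le> (\<Sum>i<m. (b / m)\<^sup>2)"
      by (rule sum_mono)
    with W have W': "(2 * sin (pi / 2 ^ Suc n))\<^sup>2 * (\<Sum>i<m. (hnorm H (g i))\<^sup>2)
        \<le> m * (b / m)\<^sup>2"
      by simp
    have "(\<Sum>i<m. a\<^sup>2) \<le> (\<Sum>i<m. (hnorm H (g i))\<^sup>2)"
      using far \<open>a \<ge> 0\<close> by (intro sum_mono power_mono) (auto simp: g_def hdist_def)
    then have "(2 * sin (pi / 2 ^ Suc n))\<^sup>2 * (m * a\<^sup>2)
        \<le> (2 * sin (pi / 2 ^ Suc n))\<^sup>2 * (\<Sum>i<m. (hnorm H (g i))\<^sup>2)"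
      by (intro mult_left_mono) auto
    then have "(2 * sin (pi / 2 ^ Suc n))\<^sup>2 * (m * a\<^sup>2) \<le> m * (b / m)\<^sup>2"
      using W' by (rule order_trans)
    then have "(2 * m * sin (pi / 2 ^ Suc n) * a)\<^sup>2 \<le> b\<^sup>2"
      using m by (simp add: field_simps power2_eq_square)
    then have "2 * m * sin (pi / 2 ^ Suc n) * a \<le> b"
      using \<open>b \<ge> 0\<close> by (rule power2_le_imp_le)
    then show ?thesis
      by (simp add: m_def)
  qed
  have "(\<lambda>x::real. sin x / x) \<midarrow>0\<rightarrow> 1"
    using DERIV_sin[of 0] by (simp add: DERIV_def)
  moreover have "filterlim (\<lambda>n. pi / 2 ^ Suc n) (at 0) sequentially"
    by (intro filterlim_atI) (real_asymp | simp)+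
  ultimately have "(\<lambda>n. sin (pi / 2 ^ Suc n) / (pi / 2 ^ Suc n)) \<longlonglongrightarrow> 1"
    by (rule filterlim_compose)
  then have "(\<lambda>n. pi * a * (sin (pi / 2 ^ Suc n) / (pi / 2 ^ Suc n))) \<longlonglongrightarrow> pi * a * 1"
    by (intro tendsto_intros)
  moreover have "pi * a * (sin (pi / 2 ^ Suc n) / (pi / 2 ^ Suc n))
      = 2 ^ Suc n * sin (pi / 2 ^ Suc n) * a" for n
    by simp
  ultimately have "(\<lambda>n. 2 ^ Suc n * sin (pi / 2 ^ Suc n) * a) \<longlonglongrightarrow> pi * a"
    by (simp only: mult_1_right)
  then show ?thesis
    using step by (intro LIMSEQ_le_const2[of _ "pi * a" b]) (auto intro: exI[of _ 1] simp del: power_Suc)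
qed

end

section \<open>The least distortion\<close>

text \<open>Only one closed geodesic of the torus is needed: the circle in a coordinate direction
\<open>k\<close>. It has length $1$ and its antipodal points have distance $1/2$ in the torus. If
the factors of the distortion are finite, say \<open>b\<close> and \<open>\<beta>\<close>, then
its image has speed at most \<open>b\<close> and antipodal distances at least $1/(2\beta)$, so
$\pi/(2\beta) \le b$. An infinite factor makes the distortion infinite because both factors are
positive.\<close>

lemma distortion_lower_bound:
  fixes \<phi> :: "'n::finite torus \<Rightarrow> 'u"
  assumes "euclidean_embedding H \<phi>"
  shows "ennreal (pi / 2) \<le> distortion (hdist H) \<phi>"
proof -
  interpret complex_hilbert_space H
    using assms by (simp add: euclidean_embedding_def)
  have \<phi>: "\<phi> p \<in> carrier H" and inj: "\<phi> p = \<phi> q \<longleftrightarrow> p = q" for p q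
    using assms by (auto simp: euclidean_embedding_def inj_eq)
  define A where "A = (SUP (p, q)\<in>{(p, q). p \<noteq> q}. ennreal (hdist H (\<phi> p) (\<phi> q) / torus_dist p q))"
  define B where "B = (SUP (p, q)\<in>{(p, q). p \<noteq> q}. ennreal (torus_dist p q / hdist H (\<phi> p) (\<phi> q)))"
  have A: "ennreal (hdist H (\<phi> p) (\<phi> q) / torus_dist p q) \<le> A"
    and B: "ennreal (torus_dist p q / hdist H (\<phi> p) (\<phi> q)) \<le> B" if "p \<noteq> q" for p q
    using that unfolding A_def B_def by (auto intro!: SUP_upper2[of "(p, q)"])
  fix k :: 'n
  define P :: "real \<Rightarrow> 'n torus" where "P t = abs_torus (axis k t)" for t
  have P_le: "torus_dist (P s) (P t) \<le> \<bar>s - t\<bar>" for s t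
  proof -
    have "axis k s - axis k t = axis k (s - t)"
      by (simp add: vec_eq_iff axis_def)
    then show ?thesis
      using torus_dist_le_norm[of "axis k s" "axis k t"] by (simp add: P_def norm_eq_sqrt_inner inner_axis_axis)
  qed
  have P_far: "1 / 2 \<le> torus_dist (P (t + 1 / 2)) (P t)" for t
    unfolding P_def by (rule torus_dist_antipodal)
  have P_ne: "P (t + 1 / 2) \<noteq> P t" for t
    using P_far[of t] P_le[of t t] by auto
  have period: "P (t + 1) = P t" for t
    by (simp add: P_def abs_torus_eq_iff int_lattice_def axis_def)
  have pos: "hdist H (\<phi> (P (1 / 2))) (\<phi> (P 0)) > 0" "torus_dist (P (1 / 2)) (P 0) > 0"
    using P_ne[of 0] by (auto intro!: hdist_pos torus_dist_pos simp: \<phi> inj)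
  have "A > 0" "B > 0"
    using A[OF P_ne[of 0]] B[OF P_ne[of 0]] pos by (auto intro: less_le_trans[rotated])
  show ?thesis
  proof (cases "A = \<infinity> \<or> B = \<infinity>")
    case True
    then have "A * B = \<infinity>"
      using \<open>A > 0\<close> \<open>B > 0\<close> by (auto simp: infinity_ennreal_def ennreal_mult_eq_top_iff)
    then show ?thesis
      by (simp add: distortion_def A_def B_def)
  next
    case False
    then obtain b \<beta> where b: "A = ennreal b" "b \<ge> 0" and \<beta>: "B = ennreal \<beta>" "\<beta> \<ge> 0"
      unfolding infinity_ennreal_def by (metis ennreal_cases)
    with \<open>B > 0\<close> have "\<beta> > 0"
      by simp
    have upper: "hdist H (\<phi> p) (\<phi> q) \<le> b * torus_dist p q"
      and lower: "torus_dist p q \<le> \<beta> * hdist H (\<phi> p) (\<phi> q)" if "p \<noteq> q" for p q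
    proof -
      have "torus_dist p q > 0" "hdist H (\<phi> p) (\<phi> q) > 0"
        using that by (auto intro!: hdist_pos torus_dist_pos simp: \<phi> inj)
      then show "hdist H (\<phi> p) (\<phi> q) \<le> b * torus_dist p q"
        "torus_dist p q \<le> \<beta> * hdist H (\<phi> p) (\<phi> q)"
        using A[OF that] B[OF that] b \<beta> by (simp_all add: field_simps)
    qed
    have "pi * (1 / (2 * \<beta>)) \<le> b"
    proof (rule closed_curve_antipodal_bound[of "\<lambda>t. \<phi> (P t)"])
      show "hdist H (\<phi> (P s)) (\<phi> (P t)) \<le> b * \<bar>s - t\<bar>" for s t
      proof (cases "P s = P t")
        case True
        then show ?thesis
          using \<open>b \<ge> 0\<close> by (simp add: hdist_self \<phi>)
      next
        case False
        then show ?thesis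
          using order_trans[OF upper[OF False] mult_left_mono[OF P_le \<open>b \<ge> 0\<close>]] by blast
      qed
      show "1 / (2 * \<beta>) \<le> hdist H (\<phi> (P (t + 1 / 2))) (\<phi> (P t))" for t
        using order_trans[OF P_far lower[OF P_ne]] \<open>\<beta> > 0\<close> by (simp add: field_simps)
    qed (use \<open>\<beta> > 0\<close> in \<open>simp_all add: \<phi> period\<close>)
    then have "pi / 2 \<le> b * \<beta>"
      using \<open>\<beta> > 0\<close> by (simp add: field_simps)
    then show ?thesis
      using b \<beta> unfolding distortion_def A_def[symmetric] B_def[symmetric]
      by (simp add: ennreal_leI flip: ennreal_mult)
  qed
qed

theorem theorem6p1:
  assumes "(UNIV :: real set) \<lesssim> (UNIV :: 'u set)"
  shows "inj (standard_embedding :: 'n::finite torus \<Rightarrow> real^('n \<times> 2))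
    \<and> distortion dist (standard_embedding :: 'n torus \<Rightarrow> real^('n \<times> 2))
        = least_distortion TYPE('u) TYPE('n)
    \<and> least_distortion TYPE('u) TYPE('n) = ennreal (pi / 2)"
proof -
  obtain H :: "'u inner_space" and J :: "real^('n \<times> 2) \<Rightarrow> 'u"
    where H: "complex_hilbert_space H" and J: "range J \<subseteq> carrier H" "inj J"
    and isometry: "\<And>x y. hdist H (J x) (J y) = dist x y"
    by (rule real_euclidean_space_into_complex_hilbert_space[OF assms, where 'm = "'n \<times> 2"]) (rule that)
  let ?\<phi> = "standard_embedding :: 'n torus \<Rightarrow> real^('n \<times> 2)"
  have "euclidean_embedding H (\<lambda>p. J (?\<phi> p))"
    using H J inj_compose[OF J(2) inj_standard_embedding]
    by (auto simp: euclidean_embedding_def o_def)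
  moreover have "distortion (hdist H) (\<lambda>p. J (?\<phi> p)) = distortion dist ?\<phi>"
    by (simp add: distortion_def isometry)
  ultimately have "least_distortion TYPE('u) TYPE('n) \<le> distortion dist ?\<phi>"
    unfolding least_distortion_def by (intro INF_lower2[of "(H, \<lambda>p. J (?\<phi> p))"]) auto
  moreover have "distortion dist ?\<phi> \<le> ennreal (pi / 2)"
    by (rule distortion_standard_embedding_le)
  moreover have "ennreal (pi / 2) \<le> least_distortion TYPE('u) TYPE('n)"
    unfolding least_distortion_def by (rule INF_greatest) (auto intro: distortion_lower_bound)
  ultimately show ?thesis
    using inj_standard_embedding by auto
qed

end
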